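(* Let $(W,S)$ be a Coxeter system and let $w\in W$. Then the set $\{w^{S\setminus\{s\}}: s\in D_R(w)\}$ has a join (least upper bound) in the poset $(W,\leq_R)$, and this join is $w$, i.e. $$w=\bigvee_{s\in D_R(w)}w^{S\setminus\{s\}}.$$
   Context: $(W,S)$ is a Coxeter system: $W$ is the group with generating set $S$ (not assumed finite) and relations $(st)^{m(s,t)}=e$ for $s,t\in S$, where $m:S\times S\to\{1,2,\ldots,\infty\}$ is a symmetric Coxeter matrix with $m(s,t)=1$ if and only if $s=t$ (the value $\infty$ means no relation is imposed). The length function is $\ell:W\to\mathbb{N}$, where $\ell(w)$ is the minimal length of a word in $S$ representing $w$. For $w\in W$, $D_R(w):=\{s\in S:\ell(ws)<\ell(w)\}$. The right weak order $\leq_R$ on $W$ is the partial order whose covering relations are: $v$ covers $u$ if and only if $\ell(u)<\ell(v)$ and $u^{-1}v\in S$. For $J\subseteq S$, $W_J$ is the subgroup of $W$ generated by $J$, and $w^J$ denotes the unique element of minimal length in the coset $wW_J$. The symbol $\bigvee$ denotes the join in $(W,\leq_R)$, which is a complete meet-semilattice in which joins need not exist in general. *)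

theory Defs
  imports "HOL-Algebra.Generated_Groups" "HOL-Algebra.Lattice" "HOL-Library.Extended_Nat"
begin

text \<open>Group words over \<open>A\<close> are lists of signed letters: \<open>(x, True)\<close> stands for \<open>x\<close> and
  \<open>(x, False)\<close> for its formal inverse.\<close>

type_synonym 'g gword = "('g \<times> bool) list"

definition gwords :: "'g set \<Rightarrow> 'g gword set" where
  "gwords A = lists (A \<times> UNIV)"

definition gword_eval :: "('g, 'b) monoid_scheme \<Rightarrow> 'g gword \<Rightarrow> 'g" where
  "gword_eval G u =
     foldr (\<lambda>(x, b) y. (if b then x else inv\<^bsub>G\<^esub> x) \<otimes>\<^bsub>G\<^esub> y) u \<one>\<^bsub>G\<^esub>"

text \<open>Equality of words in the group with generators \<open>A\<close> and relators \<open>R\<close>: the congruence generated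
  by free cancellation and by \<open>r = e\<close> for \<open>r \<in> R\<close>.\<close>

inductive presented_eq :: "'g set \<Rightarrow> 'g gword set \<Rightarrow> 'g gword \<Rightarrow> 'g gword \<Rightarrow> bool"
  for A R where
  refl: "u \<in> gwords A \<Longrightarrow> presented_eq A R u u"
| sym: "presented_eq A R u v \<Longrightarrow> presented_eq A R v u"
| trans: "presented_eq A R u v \<Longrightarrow> presented_eq A R v w \<Longrightarrow> presented_eq A R u w"
| cancel: "\<lbrakk>u \<in> gwords A; v \<in> gwords A; x \<in> A\<rbrakk>
    \<Longrightarrow> presented_eq A R (u @ [(x, b), (x, \<not> b)] @ v) (u @ v)"
| relator: "\<lbrakk>u \<in> gwords A; v \<in> gwords A; r \<in> R\<rbrakk>
    \<Longrightarrow> presented_eq A R (u @ r @ v) (u @ v)"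

text \<open>\<open>G\<close> is generated by \<open>A \<subseteq> G\<close>, and evaluation of words induces an isomorphism from
  \<open>\<langle>A | R\<rangle>\<close> onto \<open>G\<close>.\<close>

definition has_presentation :: "('g, 'b) monoid_scheme \<Rightarrow> 'g set \<Rightarrow> 'g gword set \<Rightarrow> bool" where
  "has_presentation G A R \<longleftrightarrow>
     group G \<and> A \<subseteq> carrier G \<and> generate G A = carrier G \<and> R \<subseteq> gwords A \<and>
     (\<forall>u \<in> gwords A. \<forall>v \<in> gwords A.
        gword_eval G u = gword_eval G v \<longleftrightarrow> presented_eq A R u v)"

definition coxeter_matrix :: "'g set \<Rightarrow> ('g \<Rightarrow> 'g \<Rightarrow> enat) \<Rightarrow> bool" where
  "coxeter_matrix S m \<longleftrightarrow>
     (\<forall>s\<in>S. \<forall>t\<in>S. 1 \<le> m s t \<and> m s t = m t s \<and> (m s t = 1 \<longleftrightarrow> s = t))"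

definition coxeter_relators :: "'g set \<Rightarrow> ('g \<Rightarrow> 'g \<Rightarrow> enat) \<Rightarrow> 'g gword set" where
  "coxeter_relators S m =
     {concat (replicate n [(s, True), (t, True)]) | n s t. s \<in> S \<and> t \<in> S \<and> m s t = enat n}"

definition coxeter_system ::
    "('g, 'b) monoid_scheme \<Rightarrow> 'g set \<Rightarrow> ('g \<Rightarrow> 'g \<Rightarrow> enat) \<Rightarrow> bool" where
  "coxeter_system W S m \<longleftrightarrow>
     coxeter_matrix S m \<and> has_presentation W S (coxeter_relators S m)"

definition cox_length :: "('g, 'b) monoid_scheme \<Rightarrow> 'g set \<Rightarrow> 'g \<Rightarrow> nat" where
  "cox_length W S w =
     (LEAST n. \<exists>ss \<in> lists S. length ss = n \<and> foldr (\<otimes>\<^bsub>W\<^esub>) ss \<one>\<^bsub>W\<^esub> = w)"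

definition right_descents :: "('g, 'b) monoid_scheme \<Rightarrow> 'g set \<Rightarrow> 'g \<Rightarrow> 'g set" where
  "right_descents W S w = {s \<in> S. cox_length W S (w \<otimes>\<^bsub>W\<^esub> s) < cox_length W S w}"

definition weak_covers :: "('g, 'b) monoid_scheme \<Rightarrow> 'g set \<Rightarrow> 'g \<Rightarrow> 'g \<Rightarrow> bool" where
  "weak_covers W S u v \<longleftrightarrow>
     u \<in> carrier W \<and> v \<in> carrier W \<and>
     cox_length W S u < cox_length W S v \<and> inv\<^bsub>W\<^esub> u \<otimes>\<^bsub>W\<^esub> v \<in> S"

definition right_weak_order :: "('g, 'b) monoid_scheme \<Rightarrow> 'g set \<Rightarrow> 'g gorder" where
  "right_weak_order W S =
     \<lparr>carrier = carrier W, eq = (=), le = (weak_covers W S)\<^sup>*\<^sup>*\<rparr>"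

definition min_coset_rep :: "('g, 'b) monoid_scheme \<Rightarrow> 'g set \<Rightarrow> 'g \<Rightarrow> 'g set \<Rightarrow> 'g" where
  "min_coset_rep W S w J =
     (THE x. is_arg_min (cox_length W S) (\<lambda>x. x \<in> w <#\<^bsub>W\<^esub> generate W J) x)"

lemma partial_order_right_weak_order: "partial_order (right_weak_order W S)"
proof -
  have length_mono: "cox_length W S u < cox_length W S v \<or> u = v"
    if "(weak_covers W S)\<^sup>*\<^sup>* u v" for u v
    using that by induction (auto simp: weak_covers_def)
  have "u = v" if "(weak_covers W S)\<^sup>*\<^sup>* u v" "(weak_covers W S)\<^sup>*\<^sup>* v u" for u v
    using length_mono[OF that(1)] length_mono[OF that(2)] by auto
  then show ?thesis
    by unfold_locales (auto simp: right_weak_order_def)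
qed

end

theory Submission
  imports Defs
begin

text \<open>To each \<open>w\<close> belongs its set of inversions \<open>N(w)\<close>, the reflections \<open>t\<close> (conjugates of
  generators) with \<open>\<ell>(tw) < \<ell>(w)\<close>. The weak order is inclusion of inversion sets
  (\<open>weak_le_imp_inversions_subset\<close>, \<open>inversions_subset_imp_weak_le\<close>), so the theorem follows from
  \<open>N(w) = \<Union>\<^sub>s N(w\<^sup>J)\<close>, where \<open>s\<close> runs through the right descents of \<open>w\<close> and \<open>J = S - {s}\<close>.
  Minimality of \<open>w\<^sup>J\<close> in its coset gives \<open>N(w\<^sup>J) \<subseteq> N(w)\<close>.

  For the other inclusion (\<open>inversions_covered\<close>) let \<open>t \<in> N(w)\<close> and consider the reflection
  \<open>r = w\<^sup>-\<^sup>1tw\<close>, for which \<open>\<ell>(wr) < \<ell>(w)\<close>. If \<open>t\<close> lies outside \<open>N(w\<^sup>J)\<close>, then writing \<open>w = w\<^sup>Jv\<close> with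
  \<open>v \<in> W\<^sub>J\<close> shows that \<open>t\<close> comes from an inversion of \<open>v\<close>, hence \<open>r \<in> W\<^sub>J\<close>. If this happened for
  every descent \<open>s\<close>, then \<open>r\<close> would lie in the intersection of the groups \<open>W\<^sub>J\<close>, which is the parabolic
  subgroup generated by the non-descents of \<open>w\<close> (\<open>parabolic_Inter\<close>). But an element without descents
  in \<open>K\<close> is the shortest element of its coset modulo \<open>W\<^sub>K\<close> (\<open>no_descent_shortest\<close>), which contradicts
  \<open>\<ell>(wr) < \<ell>(w)\<close>.

  Inversion sets are constructed from the presentation. The reflections crossed an odd number of
  times by the path of a word from the identity to \<open>w\<close> form a set that changes neither under
  cancellation nor under a relator \<open>(st)\<^sup>m\<close>, since such a relator crosses each of its reflections an
  even number of times. This yields a function \<open>N\<close> on the group with the cocycle rule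
  \<open>N(xy) = N(x) \<triangle> x N(y) x\<^sup>-\<^sup>1\<close> (\<open>inversions_mult\<close>), and the strong exchange property (\<open>exchange\<close>)
  links it to the length function.\<close>

section \<open>Words and the presentation\<close>

locale coxeter_group = group W for W :: "('g, 'b) monoid_scheme" (structure) +
  fixes S :: "'g set" and m :: "'g \<Rightarrow> 'g \<Rightarrow> enat"
  assumes coxeter: "coxeter_system W S m"
begin

abbreviation len :: "'g \<Rightarrow> nat" where
  "len \<equiv> cox_length W S"

abbreviation wprod :: "'g list \<Rightarrow> 'g" where
  "wprod ss \<equiv> foldr (\<otimes>) ss \<one>"

abbreviation conj_by :: "'g \<Rightarrow> 'g \<Rightarrow> 'g" where
  "conj_by x t \<equiv> inv x \<otimes> t \<otimes> x"

lemma presentation: "has_presentation W S (coxeter_relators S m)"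
  using coxeter by (simp add: coxeter_system_def)

lemma gens_closed: "S \<subseteq> carrier W"
  using presentation by (simp add: has_presentation_def)

lemma gen_closed [simp]: "s \<in> S \<Longrightarrow> s \<in> carrier W"
  using gens_closed by blast

lemma generate_gens: "generate W S = carrier W"
  using presentation by (simp add: has_presentation_def)

lemma generate_closed: "J \<subseteq> S \<Longrightarrow> x \<in> generate W J \<Longrightarrow> x \<in> carrier W"
  using generate_incl gens_closed by blast

lemma generate_subgroup: "J \<subseteq> S \<Longrightarrow> subgroup (generate W J) W"
  using generate_is_subgroup gens_closed by blast

lemma wprod_closed [simp]: "ss \<in> lists S \<Longrightarrow> wprod ss \<in> carrier W"
  by (induction ss) auto

declare foldr_append [simp del]

lemma wprod_append:
  "us \<in> lists S \<Longrightarrow> vs \<in> lists S \<Longrightarrow> wprod (us @ vs) = wprod us \<otimes> wprod vs"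
  by (induction us) (auto simp: m_assoc foldr_append)

lemma inv_cancel_left [simp]:
  assumes "x \<in> carrier W" "y \<in> carrier W"
  shows "inv x \<otimes> (x \<otimes> y) = y" and "x \<otimes> (inv x \<otimes> y) = y"
  using assms by (simp_all add: m_assoc[symmetric])

lemma conj_by_mult:
  "\<lbrakk>x \<in> carrier W; y \<in> carrier W; t \<in> carrier W\<rbrakk>
    \<Longrightarrow> conj_by (x \<otimes> y) t = conj_by y (conj_by x t)"
  by (simp add: inv_mult_group m_assoc)

lemma conj_by_eq_iff:
  assumes "x \<in> carrier W" "t \<in> carrier W" "r \<in> carrier W"
  shows "conj_by x t = r \<longleftrightarrow> t = x \<otimes> r \<otimes> inv x"
proof -
  have "conj_by x t = r \<longleftrightarrow> t \<otimes> x = x \<otimes> r"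
    using assms by (metis inv_closed inv_solve_left m_assoc m_closed)
  also have "\<dots> \<longleftrightarrow> t = x \<otimes> r \<otimes> inv x"
    using assms by (metis inv_solve_right m_closed)
  finally show ?thesis .
qed

lemma relator_power:
  assumes "s \<in> S" "t \<in> S" "m s t = enat n"
  shows "(s \<otimes> t) [^] n = \<one>"
proof -
  let ?r = "concat (replicate n [(s, True), (t, True)])"
  have r: "?r \<in> coxeter_relators S m"
    using assms by (auto simp: coxeter_relators_def)
  moreover have gw: "[] \<in> gwords S" "?r \<in> gwords S"
    using assms by (auto simp: gwords_def split: if_splits)
  ultimately have "presented_eq S (coxeter_relators S m) ?r []"
    using presented_eq.relator[of "[]" S "[]" ?r "coxeter_relators S m"] by simp
  then have "gword_eval W ?r = gword_eval W []"
    using presentation gw unfolding has_presentation_def by blast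
  moreover have "gword_eval W (concat (replicate k [(s, True), (t, True)])) = (s \<otimes> t) [^] k" for k
  proof (induction k)
    case (Suc k)
    then show ?case
      using assms nat_pow_Suc2[of "s \<otimes> t" k] by (simp add: gword_eval_def m_assoc)
  qed (simp add: gword_eval_def)
  ultimately show ?thesis
    by (simp add: gword_eval_def)
qed

text \<open>The diagonal entry \<open>m(s,s) = 1\<close> contributes the relator \<open>ss\<close>.\<close>

lemma gen_involution [simp]: "s \<in> S \<Longrightarrow> s \<otimes> s = \<one>"
  using relator_power[of s s 1] coxeter
  by (simp add: coxeter_system_def coxeter_matrix_def one_enat_def)

lemma gen_inv [simp]: "s \<in> S \<Longrightarrow> inv s = s"
  by (simp add: gen_involution inv_equality)

lemma gen_cancel_left [simp]: "s \<in> S \<Longrightarrow> y \<in> carrier W \<Longrightarrow> s \<otimes> (s \<otimes> y) = y"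
  by (simp add: m_assoc[symmetric])

text \<open>Since the generators are involutions, the signs of the letters can be forgotten.\<close>

lemma gword_eval_wprod: "u \<in> gwords S \<Longrightarrow> gword_eval W u = wprod (map fst u)"
  unfolding gword_eval_def gwords_def by (induction u) (auto simp: case_prod_beta)

lemma generate_words:
  assumes "J \<subseteq> S"
  shows "generate W J = wprod ` lists J"
proof
  have JS: "lists J \<subseteq> lists S"
    using assms by (simp add: lists_mono)
  show "generate W J \<subseteq> wprod ` lists J"
  proof
    fix x assume "x \<in> generate W J"
    then show "x \<in> wprod ` lists J"
    proof induction
      case one
      then show ?case by (auto intro!: image_eqI[of _ _ "[]"])
    next
      case (incl h)
      then show ?case using assms by (auto intro!: image_eqI[of _ _ "[h]"])
    next
      case (inv h)
      then show ?case using assms by (auto intro!: image_eqI[of _ _ "[h]"] simp: subset_iff)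
    next
      case (eng h1 h2)
      then obtain us vs where "us \<in> lists J" "vs \<in> lists J" "h1 = wprod us" "h2 = wprod vs"
        by blast
      then show ?case
        using wprod_append[of us vs] subsetD[OF JS]
        by (intro image_eqI[of _ _ "us @ vs"]) simp_all
    qed
  qed
  have "ss \<in> lists J \<Longrightarrow> wprod ss \<in> generate W J" for ss
    by (induction ss) (auto intro: generate.intros)
  then show "wprod ` lists J \<subseteq> generate W J" by blast
qed

section \<open>Inversions of a word\<close>

text \<open>The word \<open>s\<^sub>1 \<dots> s\<^sub>k\<close> crosses the reflections \<open>t\<^sub>i = s\<^sub>1 \<dots> s\<^sub>i \<dots> s\<^sub>1\<close>, one for each letter. The set
  collects those that occur an odd number of times among \<open>t\<^sub>1, \<dots>, t\<^sub>k\<close>; it need not be made of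
  all the \<open>t\<^sub>i\<close>, because the word may fail to be reduced.\<close>

fun word_inversions :: "'g list \<Rightarrow> 'g set" where
  "word_inversions [] = {}"
| "word_inversions (s # ss) = {t \<in> carrier W. (t = s) \<noteq> (conj_by s t \<in> word_inversions ss)}"

lemma word_inversions_closed: "word_inversions ss \<subseteq> carrier W"
  by (cases ss) auto

lemma word_inversions_conj_one:
  "{t \<in> carrier W. \<one> \<otimes> t \<otimes> \<one> \<in> word_inversions ss} = word_inversions ss"
proof -
  have "{t \<in> carrier W. \<one> \<otimes> t \<otimes> \<one> \<in> word_inversions ss} = {t \<in> carrier W. t \<in> word_inversions ss}"
    by auto
  then show ?thesis using word_inversions_closed by blast
qed

lemma word_inversions_append:
  assumes "us \<in> lists S" "vs \<in> lists S"
  shows "word_inversions (us @ vs) =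
    {t \<in> carrier W. (t \<in> word_inversions us) \<noteq> (conj_by (wprod us) t \<in> word_inversions vs)}"
  using assms
proof (induction us)
  case Nil
  then show ?case by (simp add: word_inversions_conj_one)
next
  case (Cons s us)
  then show ?case
    using conj_by_mult[of s "wprod us"] by auto
qed

text \<open>The reflections crossed by \<open>stst\<dots>\<close> are \<open>s, sts, ststs, \<dots>\<close>, that is \<open>(st)\<^sup>is\<close>. Counting
  them with a sum makes the parity of multiplicities explicit, which is what the relators need.\<close>

lemma word_inversions_dihedral:
  assumes st: "s \<in> S" "t \<in> S"
  shows "word_inversions (concat (replicate k [s, t])) =
    {r \<in> carrier W. odd (\<Sum>i<2 * k. of_bool ((s \<otimes> t) [^] i \<otimes> s = r) :: nat)}"
proof (induction k)
  case (Suc k)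
  let ?x = "s \<otimes> t"
  have x: "?x \<in> carrier W" using st by simp
  \<comment> \<open>Both sides equal \<open>sts\<close>; this makes conjugation by \<open>st\<close> shift the index of \<open>(st)\<^sup>is\<close> by two.\<close>
  have sx: "s \<otimes> inv ?x = ?x \<otimes> s"
    using st by (simp add: inv_mult_group m_assoc)
  have conj: "conj_by ?x r = ?x [^] i \<otimes> s \<longleftrightarrow> ?x [^] Suc (Suc i) \<otimes> s = r"
    if "r \<in> carrier W" for r i
  proof -
    have "?x \<otimes> (?x [^] i \<otimes> s) \<otimes> inv ?x = ?x \<otimes> ?x [^] i \<otimes> (s \<otimes> inv ?x)"
      using st x by (simp add: m_assoc)
    also have "\<dots> = ?x \<otimes> ?x [^] i \<otimes> ?x \<otimes> s"
      unfolding sx using st x by (simp add: m_assoc)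
    also have "\<dots> = ?x [^] Suc (Suc i) \<otimes> s"
      using st x by (simp add: nat_pow_Suc2[symmetric] del: nat_pow_Suc)
    finally show ?thesis
      using conj_by_eq_iff[OF x that, of "?x [^] i \<otimes> s"] st x by auto
  qed
  have two: "r \<in> word_inversions [s, t] \<longleftrightarrow> (s = r) \<noteq> (?x \<otimes> s = r)" if "r \<in> carrier W" for r
    using conj_by_eq_iff[of s r t] that st by auto
  have "r \<in> word_inversions (concat (replicate (Suc k) [s, t])) \<longleftrightarrow>
      odd (\<Sum>i<2 * Suc k. of_bool (?x [^] i \<otimes> s = r) :: nat)" if r: "r \<in> carrier W" for r
  proof -
    have lists: "concat (replicate k [s, t]) \<in> lists S"
      using st by (auto split: if_splits)
    have "r \<in> word_inversions (concat (replicate (Suc k) [s, t])) \<longleftrightarrow>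
      (r \<in> word_inversions [s, t]) \<noteq> (conj_by ?x r \<in> word_inversions (concat (replicate k [s, t])))"
      using word_inversions_append[of "[s, t]", OF _ lists] st r by simp
    also have "\<dots> \<longleftrightarrow> ((s = r) \<noteq> (?x \<otimes> s = r)) \<noteq>
        odd (\<Sum>i<2 * k. of_bool (?x [^] Suc (Suc i) \<otimes> s = r) :: nat)"
      unfolding two[OF r] Suc.IH conj[OF r, symmetric] using r x
      by (simp add: eq_commute[of "_ \<otimes> _ \<otimes> _"])
    also have "\<dots> \<longleftrightarrow> odd (\<Sum>i<2 * Suc k. of_bool (?x [^] i \<otimes> s = r) :: nat)"
      using st x by (simp add: sum.lessThan_Suc_shift del: sum.lessThan_Suc nat_pow_Suc)
    finally show ?thesis .
  qed
  then show ?case using word_inversions_closed by blast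
qed simp

text \<open>If \<open>(st)\<^sup>n = e\<close>, then the \<open>2n\<close> reflections \<open>(st)\<^sup>is\<close> repeat with period \<open>n\<close>, so every reflection
  occurs an even number of times.\<close>

lemma word_inversions_relator:
  assumes "s \<in> S" "t \<in> S" "(s \<otimes> t) [^] n = \<one>"
  shows "word_inversions (concat (replicate n [s, t])) = {}"
proof -
  let ?f = "\<lambda>r i. of_bool ((s \<otimes> t) [^] i \<otimes> s = r) :: nat"
  have per: "?f r (n + i) = ?f r i" for r i
    using assms by (simp add: nat_pow_mult[symmetric])
  have split: "(\<Sum>i<n + k. ?f r i) = (\<Sum>i<n. ?f r i) + (\<Sum>i<k. ?f r (n + i))" for k r
    by (induction k) auto
  have "even (\<Sum>i<2 * n. ?f r i)" for r
    using split[of r n] per by (simp add: mult_2)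
  then show ?thesis
    using word_inversions_dihedral[OF assms(1,2)] by simp
qed

lemma word_inversions_presented_eq:
  assumes "presented_eq S (coxeter_relators S m) u v"
  shows "u \<in> gwords S \<and> v \<in> gwords S \<and> word_inversions (map fst u) = word_inversions (map fst v)"
proof -
  have lists: "map fst u \<in> lists S" if "u \<in> gwords S" for u
    using that by (fastforce simp: gwords_def)
  have insert: "word_inversions (map fst (u @ r @ v)) = word_inversions (map fst (u @ v))"
    if "u \<in> gwords S" "v \<in> gwords S" "r \<in> gwords S"
      "word_inversions (map fst r) = {}" "wprod (map fst r) = \<one>" for u v r
  proof -
    have "word_inversions (map fst (r @ v)) = word_inversions (map fst v)"
      using word_inversions_append[OF lists[OF that(3)] lists[OF that(2)]] that(4,5)
      by (simp add: word_inversions_conj_one)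
    moreover have "map fst (r @ v) \<in> lists S"
      using lists[OF that(3)] lists[OF that(2)] by simp
    ultimately show ?thesis
      unfolding map_append[of fst u] word_inversions_append[OF lists[OF that(1)] lists[OF that(2)]]
      using word_inversions_append[OF lists[OF that(1)], of "map fst (r @ v)"] by simp
  qed
  show ?thesis
    using assms
  proof induction
    case (cancel u v x b)
    let ?r = "[(x, b), (x, \<not> b)]"
    have "?r \<in> gwords S" "wprod (map fst ?r) = \<one>"
      using cancel(3) by (simp_all add: gwords_def)
    moreover have "word_inversions (map fst ?r) = {}"
      using cancel(3) conj_by_eq_iff[of x _ x] by auto
    ultimately show ?case
      using insert[OF cancel(1,2), of ?r] cancel
      by (simp add: gwords_def del: word_inversions.simps)
  next
    case (relator u v r)
    then obtain n s t where r: "r = concat (replicate n [(s, True), (t, True)])"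
        and st: "s \<in> S" "t \<in> S" "m s t = enat n"
      by (auto simp: coxeter_relators_def)
    have rS: "r \<in> gwords S" using r st by (auto simp: gwords_def split: if_splits)
    have fst_r: "map fst r = concat (replicate n [s, t])"
      by (simp add: r map_concat)
    have "word_inversions (map fst r) = {}"
      unfolding fst_r using st relator_power word_inversions_relator by blast
    moreover have "wprod (map fst r) = \<one>"
    proof -
      have "presented_eq S (coxeter_relators S m) r []"
        using presented_eq.relator[of "[]" S "[]" r "coxeter_relators S m"] relator(3)
        by (simp add: gwords_def)
      then have "gword_eval W r = gword_eval W []"
        using presentation rS unfolding has_presentation_def by (auto simp: gwords_def)
      then show ?thesis
        using gword_eval_wprod[OF rS] by (simp add: gword_eval_def)
    qed
    ultimately show ?case
      using relator insert rS by (auto simp: gwords_def)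
  qed auto
qed

text \<open>This is where the completeness of the relations enters: words with equal value can be
  transformed into each other by cancellations and relators.\<close>

lemma word_inversions_cong:
  assumes "us \<in> lists S" "vs \<in> lists S" "wprod us = wprod vs"
  shows "word_inversions us = word_inversions vs"
proof -
  let ?sg = "map (\<lambda>s. (s, True))"
  have gw: "?sg ss \<in> gwords S" if "ss \<in> lists S" for ss
    using that by (auto simp: gwords_def)
  have fst_sg: "map fst (?sg ss) = ss" for ss :: "'g list"
    by (induction ss) auto
  have "gword_eval W (?sg us) = gword_eval W (?sg vs)"
    using assms gword_eval_wprod gw fst_sg by metis
  then have "presented_eq S (coxeter_relators S m) (?sg us) (?sg vs)"
    using presentation gw assms unfolding has_presentation_def by blast
  then show ?thesis
    using word_inversions_presented_eq fst_sg by metis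
qed

section \<open>Inversions of a group element\<close>

definition inversions :: "'g \<Rightarrow> 'g set" where
  "inversions w = word_inversions (SOME ss. ss \<in> lists S \<and> wprod ss = w)"

lemma inversions_wprod:
  assumes "ss \<in> lists S"
  shows "inversions (wprod ss) = word_inversions ss"
proof -
  let ?P = "\<lambda>us. us \<in> lists S \<and> wprod us = wprod ss"
  have "?P (SOME us. ?P us)" using assms by (intro someI[of ?P]) simp
  then show ?thesis
    unfolding inversions_def using word_inversions_cong assms by blast
qed

lemma obtain_word:
  assumes "w \<in> carrier W"
  obtains ss where "ss \<in> lists S" "wprod ss = w"
proof -
  have "w \<in> wprod ` lists S"
    using assms generate_gens generate_words[OF order_refl] by simp
  then show thesis using that by blast
qed

lemma inversions_closed: "inversions w \<subseteq> carrier W"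
  unfolding inversions_def by (rule word_inversions_closed)

lemma inversions_one [simp]: "inversions \<one> = {}"
  using inversions_wprod[of "[]"] by simp

lemma inversions_gen [simp]: "s \<in> S \<Longrightarrow> inversions s = {s}"
proof -
  assume s: "s \<in> S"
  have "inversions (wprod [s]) = word_inversions [s]"
    using s by (intro inversions_wprod) simp
  also have "\<dots> = {s}" using s by auto
  finally show "inversions s = {s}" using s by simp
qed

text \<open>This cocycle rule \<open>N(xy) = N(x) \<triangle> x N(y) x\<^sup>-\<^sup>1\<close> is the tool for all later comparisons of inversion
  sets.\<close>

lemma inversions_mult:
  assumes "x \<in> carrier W" "y \<in> carrier W" "t \<in> carrier W"
  shows "t \<in> inversions (x \<otimes> y) \<longleftrightarrow> (t \<in> inversions x) \<noteq> (conj_by x t \<in> inversions y)"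
proof -
  obtain us vs where u: "us \<in> lists S" "wprod us = x" and v: "vs \<in> lists S" "wprod vs = y"
    using obtain_word[OF assms(1)] obtain_word[OF assms(2)] by metis
  then show ?thesis
    using inversions_wprod[of "us @ vs"] inversions_wprod[OF u(1)] inversions_wprod[OF v(1)]
      word_inversions_append[OF u(1) v(1)] assms(3) wprod_append[OF u(1) v(1)]
    by simp
qed

lemma word_inversion_letter:
  assumes "ss \<in> lists S" "t \<in> word_inversions ss"
  shows "\<exists>us s vs. ss = us @ s # vs \<and> t = wprod us \<otimes> s \<otimes> inv (wprod us)"
  using assms
proof (induction ss arbitrary: t)
  case (Cons a ss)
  then have a: "a \<in> S" and ss: "ss \<in> lists S" and t: "t \<in> carrier W" by auto
  show ?case
  proof (cases "t = a")
    case True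
    then show ?thesis using a by (intro exI[of _ "[]"]) auto
  next
    case False
    then have "conj_by a t \<in> word_inversions ss" using Cons by auto
    then obtain us s vs where u: "ss = us @ s # vs"
        "conj_by a t = wprod us \<otimes> s \<otimes> inv (wprod us)"
      using Cons.IH ss by blast
    then have cl: "s \<in> carrier W" "wprod us \<in> carrier W" using ss by auto
    have "t = a \<otimes> (wprod us \<otimes> s \<otimes> inv (wprod us)) \<otimes> inv a"
      using conj_by_eq_iff[of a t] u(2) cl a t by simp
    also have "\<dots> = wprod (a # us) \<otimes> s \<otimes> inv (wprod (a # us))"
      using cl a by (simp add: m_assoc inv_mult_group)
    finally show ?thesis using u(1) by (intro exI[of _ "a # us"]) auto
  qed
qed simp

text \<open>The strong exchange property: an inversion has the form \<open>t = usu\<^sup>-\<^sup>1\<close> for a factorization \<open>usv\<close> of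
  the word, and multiplying by \<open>t\<close> deletes that letter. Keeping track of the alphabet \<open>J\<close> makes the
  property available inside parabolic subgroups, before anything is known about their lengths.\<close>

lemma exchange:
  assumes "ss \<in> lists J" "J \<subseteq> S" "t \<in> inversions (wprod ss)"
  obtains us where "us \<in> lists J" "length us < length ss" "wprod us = t \<otimes> wprod ss"
proof -
  have ss: "ss \<in> lists S" using assms lists_mono by blast
  obtain us s vs where u: "ss = us @ s # vs" "t = wprod us \<otimes> s \<otimes> inv (wprod us)"
    using word_inversion_letter[OF ss] inversions_wprod[OF ss] assms(3) by blast
  have l: "us \<in> lists S" "s \<in> S" "vs \<in> lists S" using ss u(1) by auto
  have "t \<otimes> wprod ss = wprod us \<otimes> (s \<otimes> (inv (wprod us) \<otimes> wprod us) \<otimes> s \<otimes> wprod vs)"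
    unfolding u(2) unfolding u(1) using l wprod_append[of us "s # vs"]
    by (simp add: m_assoc del: l_inv r_inv)
  also have "\<dots> = wprod (us @ vs)"
    using l wprod_append[of us vs] by simp
  finally show thesis
    using that[of "us @ vs"] u(1) assms(1) by simp
qed

lemma inversions_parabolic:
  assumes "J \<subseteq> S" "v \<in> generate W J"
  shows "inversions v \<subseteq> generate W J"
proof
  fix t assume t: "t \<in> inversions v"
  obtain ss where ss: "ss \<in> lists J" "v = wprod ss"
    using assms generate_words by auto
  obtain us where us: "us \<in> lists J" "wprod us = t \<otimes> wprod ss"
    using exchange[OF ss(1) assms(1)] t ss(2) by blast
  have "t = wprod us \<otimes> inv v"
    using us(2) ss(2) subsetD[OF inversions_closed t] generate_closed[OF assms]
    by (simp add: m_assoc)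
  moreover have "wprod us \<in> generate W J"
    using us(1) generate_words assms(1) by auto
  ultimately show "t \<in> generate W J"
    using generate_subgroup[OF assms(1)] assms(2)
    by (simp add: subgroup.m_closed subgroup.m_inv_closed)
qed

lemma len_wprod_le: "ss \<in> lists S \<Longrightarrow> len (wprod ss) \<le> length ss"
  unfolding cox_length_def by (rule Least_le) blast

lemma obtain_reduced_word:
  assumes "w \<in> carrier W"
  obtains ss where "ss \<in> lists S" "wprod ss = w" "length ss = len w"
proof -
  let ?P = "\<lambda>n. \<exists>ss\<in>lists S. length ss = n \<and> wprod ss = w"
  have "\<exists>n. ?P n" using obtain_word[OF assms] by metis
  then have "?P (len w)" unfolding cox_length_def by (rule LeastI_ex)
  then show thesis using that by blast
qed

lemma len_inversion_less:
  assumes "w \<in> carrier W" "t \<in> inversions w"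
  shows "len (t \<otimes> w) < len w"
proof -
  obtain ss where ss: "ss \<in> lists S" "wprod ss = w" "length ss = len w"
    using obtain_reduced_word[OF assms(1)] .
  obtain us where "us \<in> lists S" "length us < length ss" "wprod us = t \<otimes> w"
    using exchange[OF ss(1)] ss(2) assms(2) by blast
  then show ?thesis using len_wprod_le ss(3) by fastforce
qed

lemma inversions_mult_gen:
  assumes "u \<in> carrier W" "s \<in> S" "t \<in> carrier W"
  shows "t \<in> inversions (u \<otimes> s) \<longleftrightarrow> (t \<in> inversions u) \<noteq> (t = u \<otimes> s \<otimes> inv u)"
  unfolding inversions_mult[OF assms(1) gen_closed[OF assms(2)] assms(3)]
    inversions_gen[OF assms(2)] singleton_iff
    conj_by_eq_iff[OF assms(1,3) gen_closed[OF assms(2)]] ..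

text \<open>The reflection \<open>p = usu\<^sup>-\<^sup>1\<close> carries \<open>u\<close> to \<open>us\<close> and back, and it is an inversion of exactly one of
  the two elements; the one that has it is the longer one.\<close>

lemma len_mult_gen:
  assumes "u \<in> carrier W" "s \<in> S"
  shows "u \<otimes> s \<otimes> inv u \<in> inversions u \<Longrightarrow> len (u \<otimes> s) < len u"
    and "u \<otimes> s \<otimes> inv u \<notin> inversions u \<Longrightarrow> len u < len (u \<otimes> s)"
proof -
  let ?p = "u \<otimes> s \<otimes> inv u"
  have p: "?p \<in> carrier W" and pu: "?p \<otimes> u = u \<otimes> s"
    using assms by (auto simp: m_assoc)
  have pus: "?p \<otimes> (u \<otimes> s) = u"
  proof -
    have "?p \<otimes> (u \<otimes> s) = ?p \<otimes> u \<otimes> s" using assms p by (simp add: m_assoc)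
    also have "\<dots> = u" unfolding pu using assms by (simp add: m_assoc)
    finally show ?thesis .
  qed
  show "?p \<in> inversions u \<Longrightarrow> len (u \<otimes> s) < len u"
    using len_inversion_less[OF assms(1), of ?p] pu by simp
  show "?p \<notin> inversions u \<Longrightarrow> len u < len (u \<otimes> s)"
    using len_inversion_less[of "u \<otimes> s" ?p] inversions_mult_gen[OF assms p] pus assms by simp
qed

section \<open>Parabolic subgroups\<close>

text \<open>In a word over \<open>J\<close> that is shortest among the words over \<open>J\<close> for \<open>v\<close>, the first letter must be an
  inversion: otherwise it would be an inversion of the rest of the word, and exchange would produce
  a shorter word over \<open>J\<close>.\<close>

lemma parabolic_descent:
  assumes "J \<subseteq> S" "v \<in> generate W J" "v \<noteq> \<one>"
  shows "\<exists>s\<in>J. s \<in> inversions v"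
proof -
  define n where "n = (LEAST n. \<exists>ss\<in>lists J. length ss = n \<and> wprod ss = v)"
  have "\<exists>n. \<exists>ss\<in>lists J. length ss = n \<and> wprod ss = v"
    using assms generate_words by auto
  then have "\<exists>ss\<in>lists J. length ss = n \<and> wprod ss = v"
    unfolding n_def by (rule LeastI_ex)
  then obtain ss where ss: "ss \<in> lists J" "length ss = n" "wprod ss = v" by blast
  have shortest: "length ss \<le> length us" if "us \<in> lists J" "wprod us = v" for us
    unfolding ss(2) n_def by (rule Least_le) (use that in blast)
  obtain s vs where s: "ss = s # vs" using ss assms(3) by (cases ss) auto
  have l: "s \<in> S" "s \<in> J" "vs \<in> lists J" "vs \<in> lists S"
    using ss(1) s assms(1) by auto
  have "s \<notin> inversions (wprod vs)"
  proof
    assume "s \<in> inversions (wprod vs)"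
    then obtain us where "us \<in> lists J" "length us < length vs" "wprod us = s \<otimes> wprod vs"
      using exchange[OF l(3) assms(1)] by blast
    then show False using shortest[of us] s ss(3) by simp
  qed
  then have "s \<in> inversions (s \<otimes> wprod vs)"
    using inversions_mult[of s "wprod vs" s] l by simp
  then show ?thesis using l s ss(3) by auto
qed

text \<open>A nontrivial element of \<open>W\<^sub>J\<close> has an inversion in \<open>J\<close>, and the only inversion of \<open>s\<close> is \<open>s\<close> itself.\<close>

lemma gens_in_parabolic: "J \<subseteq> S \<Longrightarrow> s \<in> S \<Longrightarrow> s \<in> generate W J \<Longrightarrow> s \<in> J"
  using parabolic_descent[of J s] inversions_gen[of s] inversions_one by fastforce

text \<open>A generator that is an inversion of \<open>r\<close> lies in every parabolic subgroup that contains \<open>r\<close>, so it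
  avoids all of \<open>D\<close>. Splitting it off shortens \<open>r\<close>, and induction on the length applies.\<close>

lemma parabolic_Inter:
  assumes "r \<in> carrier W" "\<And>d. d \<in> D \<Longrightarrow> r \<in> generate W (S - {d})"
  shows "r \<in> generate W (S - D)"
  using assms
proof (induction "len r" arbitrary: r rule: less_induct)
  case less
  show ?case
  proof (cases "r = \<one>")
    case True
    then show ?thesis by (simp add: generate.one)
  next
    case False
    then obtain s where s: "s \<in> S" "s \<in> inversions r"
      using parabolic_descent[of S r] less.prems(1) generate_gens by auto
    have sd: "s \<in> generate W (S - {d})" if "d \<in> D" for d
      using inversions_parabolic[OF _ less.prems(2)[OF that]] s(2) by blast
    have "s \<in> S - D"
      using sd gens_in_parabolic[OF _ s(1)] s(1) by blast
    moreover have "s \<otimes> r \<in> generate W (S - D)"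
    proof (rule less.hyps)
      show "len (s \<otimes> r) < len r"
        using len_inversion_less less.prems(1) s(2) by blast
      show "s \<otimes> r \<in> generate W (S - {d})" if "d \<in> D" for d
        using generate.eng[OF sd[OF that] less.prems(2)[OF that]] .
    qed (use s less.prems in simp)
    moreover have "r = s \<otimes> (s \<otimes> r)"
      using s less.prems(1) by (simp add: m_assoc)
    ultimately show ?thesis
      by (metis generate.eng generate.incl)
  qed
qed

section \<open>The weak order as inclusion of inversion sets\<close>

lemma weak_le_imp_inversions_subset:
  assumes "(weak_covers W S)\<^sup>*\<^sup>* u v"
  shows "inversions u \<subseteq> inversions v"
  using assms
proof induction
  case (step v w)
  let ?s = "inv v \<otimes> w"
  have vw: "v \<in> carrier W" "w \<in> carrier W" "?s \<in> S" "len v < len w"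
    using step.hyps(2) by (auto simp: weak_covers_def)
  have w: "w = v \<otimes> ?s" using vw by (simp add: m_assoc)
  have "v \<otimes> ?s \<otimes> inv v \<notin> inversions v"
    using len_mult_gen(1)[OF vw(1,3)] vw(4) w by auto
  then have "inversions v \<subseteq> inversions (v \<otimes> ?s)"
    using inversions_mult_gen[OF vw(1,3)] inversions_closed by blast
  then show ?case using step.IH w by simp
qed simp

text \<open>A generator \<open>s\<close> among the inversions of \<open>u\<^sup>-\<^sup>1v\<close> gives a step upwards from \<open>u\<close> towards \<open>v\<close>: by the
  cocycle rule \<open>p = usu\<^sup>-\<^sup>1\<close> belongs to exactly one of \<open>N(u)\<close> and \<open>N(v)\<close>, hence to \<open>N(v)\<close> alone, so that
  \<open>us\<close> covers \<open>u\<close> and \<open>N(us) = N(u) \<union> {p}\<close> still lies in \<open>N(v)\<close>. The distance \<open>\<ell>(u\<^sup>-\<^sup>1v)\<close> drops.\<close>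

lemma inversions_subset_imp_weak_le:
  assumes "u \<in> carrier W" "v \<in> carrier W" "inversions u \<subseteq> inversions v"
  shows "(weak_covers W S)\<^sup>*\<^sup>* u v"
  using assms
proof (induction "len (inv u \<otimes> v)" arbitrary: u rule: less_induct)
  case less
  let ?z = "inv u \<otimes> v"
  have z: "?z \<in> carrier W" and v: "v = u \<otimes> ?z"
    using less.prems by (auto simp: m_assoc)
  show ?case
  proof (cases "?z = \<one>")
    case True
    then have "v = u" using v less.prems(1) by simp
    then show ?thesis by simp
  next
    case False
    then obtain s where s: "s \<in> S" "s \<in> inversions ?z"
      using parabolic_descent[of S ?z] z generate_gens by auto
    let ?p = "u \<otimes> s \<otimes> inv u"
    have p: "?p \<in> carrier W" using less.prems s by simp
    have "conj_by u ?p = s" using conj_by_eq_iff[OF less.prems(1) p] s(1) by simp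
    then have "?p \<in> inversions v \<longleftrightarrow> ?p \<notin> inversions u"
      using inversions_mult[OF less.prems(1) z p] s(2) v by simp
    then have pv: "?p \<in> inversions v" and pu: "?p \<notin> inversions u"
      using less.prems(3) by auto
    have us: "u \<otimes> s \<in> carrier W" using less.prems s by simp
    have inv_us: "inv (u \<otimes> s) \<otimes> v = s \<otimes> ?z"
      using less.prems s by (simp add: inv_mult_group m_assoc)
    have "(weak_covers W S)\<^sup>*\<^sup>* (u \<otimes> s) v"
    proof (rule less.hyps)
      show "len (inv (u \<otimes> s) \<otimes> v) < len ?z"
        unfolding inv_us using len_inversion_less[OF z s(2)] .
      show "inversions (u \<otimes> s) \<subseteq> inversions v"
        using inversions_mult_gen[OF less.prems(1) s(1)] inversions_closed[of "u \<otimes> s"]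
          less.prems(3) pv by blast
    qed (use us less.prems in auto)
    moreover have "weak_covers W S u (u \<otimes> s)"
      using len_mult_gen(2)[OF less.prems(1) s(1) pu] less.prems(1) s(1) us
      by (simp add: weak_covers_def m_assoc)
    ultimately show ?thesis by (rule converse_rtranclp_into_rtranclp[rotated])
  qed
qed

section \<open>Shortest coset representatives\<close>

abbreviation shortest_in_coset :: "'g set \<Rightarrow> 'g \<Rightarrow> 'g \<Rightarrow> bool" where
  "shortest_in_coset J w x \<equiv> is_arg_min len (\<lambda>x. x \<in> w <# generate W J) x"

lemma in_coset_iff:
  assumes "J \<subseteq> S" "w \<in> carrier W"
  shows "x \<in> w <# generate W J \<longleftrightarrow> x \<in> carrier W \<and> inv x \<otimes> w \<in> generate W J"
proof
  assume "x \<in> w <# generate W J"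
  then obtain v where v: "v \<in> generate W J" "x = w \<otimes> v" by (auto simp: l_coset_def)
  then have "v \<in> carrier W" using generate_closed assms(1) by blast
  moreover from this have "inv x \<otimes> w = inv v"
    using v(2) assms(2) by (simp add: inv_mult_group m_assoc)
  ultimately show "x \<in> carrier W \<and> inv x \<otimes> w \<in> generate W J"
    using v assms subgroup.m_inv_closed[OF generate_subgroup[OF assms(1)]] by simp
next
  assume x: "x \<in> carrier W \<and> inv x \<otimes> w \<in> generate W J"
  then have "inv (inv x \<otimes> w) \<in> generate W J"
    using subgroup.m_inv_closed[OF generate_subgroup[OF assms(1)]] by simp
  moreover have "x = w \<otimes> inv (inv x \<otimes> w)"
    using x assms(2) by (simp add: inv_mult_group m_assoc)
  ultimately show "x \<in> w <# generate W J" unfolding l_coset_def by blast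
qed

text \<open>If \<open>x\<^sup>-\<^sup>1tx\<close> were in \<open>W\<^sub>J\<close>, then \<open>tx = x(x\<^sup>-\<^sup>1tx)\<close> would be a shorter element of the same coset.\<close>

lemma shortest_no_parabolic_inversion:
  assumes "J \<subseteq> S" "w \<in> carrier W" "shortest_in_coset J w x" "t \<in> inversions x"
  shows "conj_by x t \<notin> generate W J"
proof
  assume r: "conj_by x t \<in> generate W J"
  have x: "x \<in> carrier W" "inv x \<otimes> w \<in> generate W J"
    using assms(3) in_coset_iff[OF assms(1,2)] by (auto simp: is_arg_min_def)
  have t: "t \<in> carrier W" using assms(4) inversions_closed by blast
  have "inv (conj_by x t) \<otimes> (inv x \<otimes> w) \<in> generate W J"
    using r x(2) generate_subgroup[OF assms(1)]
    by (simp add: subgroup.m_closed subgroup.m_inv_closed)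
  moreover have "inv (t \<otimes> x) \<otimes> w = inv (conj_by x t) \<otimes> (inv x \<otimes> w)"
    using x t assms(2) by (simp add: inv_mult_group m_assoc)
  ultimately have "t \<otimes> x \<in> w <# generate W J"
    using in_coset_iff[OF assms(1,2)] x t by simp
  then show False
    using assms(3) len_inversion_less[OF x(1) assms(4)] by (auto simp: is_arg_min_def)
qed

text \<open>Passing from \<open>x\<close> to \<open>y = xv\<close> with \<open>v \<in> W\<^sub>J\<close> only affects reflections \<open>t\<close> with
  \<open>x\<^sup>-\<^sup>1tx \<in> N(v) \<subseteq> W\<^sub>J\<close>, and no inversion of the shortest element is of this kind.\<close>

lemma shortest_inversions_subset:
  assumes "J \<subseteq> S" "w \<in> carrier W" "shortest_in_coset J w x" "y \<in> w <# generate W J"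
  shows "inversions x \<subseteq> inversions y"
proof
  fix t assume t: "t \<in> inversions x"
  have x: "x \<in> carrier W" "inv x \<otimes> w \<in> generate W J"
    using assms(3) in_coset_iff[OF assms(1,2)] by (auto simp: is_arg_min_def)
  have y: "y \<in> carrier W" "inv y \<otimes> w \<in> generate W J"
    using assms(4) in_coset_iff[OF assms(1,2)] by auto
  have "(inv x \<otimes> w) \<otimes> inv (inv y \<otimes> w) \<in> generate W J"
    using x(2) y(2) generate_subgroup[OF assms(1)]
    by (simp add: subgroup.m_closed subgroup.m_inv_closed)
  moreover have "(inv x \<otimes> w) \<otimes> inv (inv y \<otimes> w) = inv x \<otimes> y"
    using x(1) y(1) assms(2) by (simp add: inv_mult_group m_assoc)
  ultimately have v: "inv x \<otimes> y \<in> generate W J" by simp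
  have "conj_by x t \<notin> inversions (inv x \<otimes> y)"
    using shortest_no_parabolic_inversion[OF assms(1-3) t] inversions_parabolic[OF assms(1) v]
    by blast
  moreover have "x \<otimes> (inv x \<otimes> y) = y" using x y by (simp add: m_assoc)
  ultimately show "t \<in> inversions y"
    using inversions_mult[of x "inv x \<otimes> y" t] x y t inversions_closed[of x] by auto
qed

text \<open>The representative is a definite description, so uniqueness has to be shown: two shortest elements of a
  coset have the same inversions, hence lie below each other in the weak order.\<close>

lemma min_coset_rep_shortest:
  assumes "J \<subseteq> S" "w \<in> carrier W"
  shows "shortest_in_coset J w (min_coset_rep W S w J)"
proof -
  have "w \<in> w <# generate W J"
    using in_coset_iff[OF assms] assms by (simp add: generate.one)
  then have "\<exists>x. shortest_in_coset J w x"
    using ex_has_least_nat[of "\<lambda>x. x \<in> w <# generate W J" w len]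
    by (auto simp: is_arg_min_linorder)
  moreover have "x = y" if "shortest_in_coset J w x" "shortest_in_coset J w y" for x y
  proof -
    have c: "x \<in> w <# generate W J" "y \<in> w <# generate W J"
      using that by (auto simp: is_arg_min_def)
    then have "x \<in> carrier W" "y \<in> carrier W" using in_coset_iff[OF assms] by auto
    then have "(weak_covers W S)\<^sup>*\<^sup>* x y" "(weak_covers W S)\<^sup>*\<^sup>* y x"
      using inversions_subset_imp_weak_le shortest_inversions_subset[OF assms] that c by blast+
    then show ?thesis
      using partial_order.le_antisym[OF partial_order_right_weak_order[of W S], of x y]
        \<open>x \<in> carrier W\<close> \<open>y \<in> carrier W\<close>
      by (simp add: right_weak_order_def)
  qed
  ultimately show ?thesis
    unfolding min_coset_rep_def by (intro theI'[of "shortest_in_coset J w"]) blast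
qed

text \<open>Let \<open>x\<close> be the shortest element of \<open>wW\<^sub>J\<close> and \<open>z = w\<^sup>-\<^sup>1x\<close>. If \<open>z \<noteq> e\<close>, some \<open>s \<in> J\<close> is an inversion of
  \<open>z\<close>. As \<open>s\<close> is not a descent of \<open>w\<close>, the reflection \<open>wsw\<^sup>-\<^sup>1\<close> is not an inversion of \<open>w\<close>, so the
  cocycle rule makes it an inversion of \<open>x = wz\<close>; but its conjugate by \<open>x\<close> lies in \<open>W\<^sub>J\<close>.\<close>

lemma no_descent_shortest:
  assumes "J \<subseteq> S" "w \<in> carrier W" "J \<inter> right_descents W S w = {}"
  shows "shortest_in_coset J w w"
proof -
  let ?x = "min_coset_rep W S w J"
  let ?z = "inv w \<otimes> ?x"
  note x_min = min_coset_rep_shortest[OF assms(1,2)]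
  have x: "?x \<in> carrier W" "inv ?x \<otimes> w \<in> generate W J"
    using x_min in_coset_iff[OF assms(1,2)] by (auto simp: is_arg_min_def)
  have z_inv: "?z = inv (inv ?x \<otimes> w)" using x assms(2) by (simp add: inv_mult_group)
  have z: "?z \<in> generate W J" "?z \<in> carrier W"
    using x assms(2) subgroup.m_inv_closed[OF generate_subgroup[OF assms(1)] x(2)] z_inv
    by auto
  have wz: "?x = w \<otimes> ?z" using x assms(2) by simp
  have "?z = \<one>"
  proof (rule ccontr)
    assume "?z \<noteq> \<one>"
    then obtain s where s: "s \<in> J" "s \<in> inversions ?z"
      using parabolic_descent[OF assms(1) z(1)] by blast
    then have sS: "s \<in> S" using assms(1) by blast
    let ?p = "w \<otimes> s \<otimes> inv w"
    have p: "?p \<in> carrier W" using sS assms(2) by simp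
    have conj: "conj_by w ?p = s" using conj_by_eq_iff[OF assms(2) p] sS by simp
    have "?p \<notin> inversions w"
      using len_mult_gen(1)[OF assms(2) sS] assms(3) s(1) sS by (auto simp: right_descents_def)
    then have px: "?p \<in> inversions ?x"
      using inversions_mult[OF assms(2) z(2) p] conj s(2) wz by simp
    have "conj_by ?x ?p = conj_by ?z s"
      using conj_by_mult[OF assms(2) z(2) p] conj wz by simp
    also have "\<dots> \<in> generate W J"
      using z(1) s(1) generate_subgroup[OF assms(1)]
      by (simp add: subgroup.m_closed subgroup.m_inv_closed generate.incl)
    finally show False
      using shortest_no_parabolic_inversion[OF assms(1,2) x_min px] by simp
  qed
  then have "?x = w" using wz assms(2) by simp
  then show ?thesis using x_min by simp
qed

section \<open>The join\<close>

text \<open>An inversion \<open>t\<close> missing from all the sets on the right has \<open>w\<^sup>-\<^sup>1tw\<close> in each \<open>W\<^sub>J\<close> with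
  \<open>J = S - {s}\<close>, hence in the parabolic subgroup of the non-descents, modulo which \<open>w\<close> is shortest.\<close>

lemma inversions_covered:
  assumes w: "w \<in> carrier W"
  shows "inversions w \<subseteq> (\<Union>s\<in>right_descents W S w. inversions (min_coset_rep W S w (S - {s})))"
proof
  fix t assume t: "t \<in> inversions w"
  have tc: "t \<in> carrier W" using t inversions_closed by blast
  show "t \<in> (\<Union>s\<in>right_descents W S w. inversions (min_coset_rep W S w (S - {s})))"
  proof (rule ccontr)
    assume not: "\<not> ?thesis"
    have "conj_by w t \<in> generate W (S - {s})" if s: "s \<in> right_descents W S w" for s
    proof -
      let ?J = "S - {s}"
      let ?x = "min_coset_rep W S w ?J"
      let ?v = "inv ?x \<otimes> w"
      have J: "?J \<subseteq> S" by blast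
      have x: "?x \<in> carrier W" "?v \<in> generate W ?J"
        using min_coset_rep_shortest[OF J w] in_coset_iff[OF J w] by (auto simp: is_arg_min_def)
      have v: "?v \<in> carrier W" and xv: "w = ?x \<otimes> ?v"
        using x w by (auto simp: m_assoc)
      have "t \<notin> inversions ?x" using not s by blast
      then have "conj_by ?x t \<in> inversions ?v"
        using inversions_mult[OF x(1) v tc] t xv by simp
      then have "conj_by ?x t \<in> generate W ?J"
        using inversions_parabolic[OF J x(2)] by blast
      then have "conj_by ?v (conj_by ?x t) \<in> generate W ?J"
        using x(2) generate_subgroup[OF J]
        by (simp only: subgroup.m_closed subgroup.m_inv_closed)
      then show ?thesis
        using conj_by_mult[OF x(1) v tc] xv by simp
    qed
    then have "conj_by w t \<in> generate W (S - right_descents W S w)"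
      using parabolic_Inter w tc by simp
    moreover have "shortest_in_coset (S - right_descents W S w) w w"
      by (rule no_descent_shortest) (use w in auto)
    ultimately show False
      using shortest_no_parabolic_inversion[OF _ w _ t] by blast
  qed
qed

lemma is_lub_min_coset_reps:
  assumes w: "w \<in> carrier W"
  shows "is_lub (right_weak_order W S) w
    ((\<lambda>s. min_coset_rep W S w (S - {s})) ` right_descents W S w)"
proof -
  let ?x = "\<lambda>s. min_coset_rep W S w (S - {s})"
  let ?D = "right_descents W S w"
  have x_min: "shortest_in_coset (S - {s}) w (?x s)" for s
    by (rule min_coset_rep_shortest) (use w in auto)
  have x: "?x s \<in> carrier W" for s
    using x_min[of s] in_coset_iff[of "S - {s}" w] w by (auto simp: is_arg_min_def)
  have w_coset: "w \<in> w <# generate W (S - {s})" for s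
    using in_coset_iff[of "S - {s}" w w] w by (simp add: generate.one)
  have "(weak_covers W S)\<^sup>*\<^sup>* (?x s) w" for s
    using inversions_subset_imp_weak_le[OF x w]
      shortest_inversions_subset[OF _ w x_min w_coset] by blast
  moreover have "(weak_covers W S)\<^sup>*\<^sup>* w u"
    if "u \<in> carrier W" "\<And>s. s \<in> ?D \<Longrightarrow> (weak_covers W S)\<^sup>*\<^sup>* (?x s) u" for u
  proof (rule inversions_subset_imp_weak_le[OF w that(1)])
    show "inversions w \<subseteq> inversions u"
      using inversions_covered[OF w] weak_le_imp_inversions_subset[OF that(2)] by blast
  qed
  ultimately show ?thesis
    using w x by (auto simp: least_def Upper_def right_weak_order_def)
qed

end

theorem corollary2p4:
  fixes W :: "('g, 'b) monoid_scheme" and S :: "'g set" and m :: "'g \<Rightarrow> 'g \<Rightarrow> enat" and w :: 'g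
  assumes "coxeter_system W S m"
    and "w \<in> carrier W"
  shows "is_lub (right_weak_order W S) w
           ((\<lambda>s. min_coset_rep W S w (S - {s})) ` right_descents W S w) \<and>
         w = \<Squnion>\<^bsub>right_weak_order W S\<^esub>
           ((\<lambda>s. min_coset_rep W S w (S - {s})) ` right_descents W S w)"
proof -
  interpret group W
    using assms(1) by (simp add: coxeter_system_def has_presentation_def)
  interpret coxeter_group W S m
    by unfold_locales (rule assms(1))
  let ?A = "(\<lambda>s. min_coset_rep W S w (S - {s})) ` right_descents W S w"
  have lub: "is_lub (right_weak_order W S) w ?A"
    using is_lub_min_coset_reps assms(2) .
  then have "is_lub (right_weak_order W S) (\<Squnion>\<^bsub>right_weak_order W S\<^esub> ?A) ?A"
    unfolding sup_def by (rule someI)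
  then have "w = \<Squnion>\<^bsub>right_weak_order W S\<^esub> ?A"
    using partial_order.least_unique[OF partial_order_right_weak_order lub] by blast
  with lub show ?thesis by blast
qed

end
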